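(* Suppose the conditional trajectory sampling assumption (see context) holds, the tube parameter $\theta$ is fixed after calibration, $\mathcal X_f(\theta)\oplus\mathcal S_H\subseteq\mathcal X$, and the CT-MPC problem is feasible at the state $x_k$, with optimal solution $(z^\star_{t\mid k})_{t=0}^{H}$, $(v^\star_{t\mid k})_{t=0}^{H-1}$. Let the feedback sequence $u_{t\mid k}=v^\star_{t\mid k}+Ke_{t\mid k}$ be applied over the prediction horizon, so that $x_{t\mid k}=z^\star_{t\mid k}+e_{t\mid k}$, where $e_{0\mid k}=0$ and $\mathbf E_k=(e_{1\mid k},\dots,e_{H\mid k})$ is the realized prediction-error trajectory. Then $$\mathbf E_k\in\mathcal E_\theta\ \Longrightarrow\ x_{t\mid k}\in\mathcal X\ \ (t=1,\dots,H)\quad\text{and}\quad u_{t\mid k}\in\mathcal U\ \ (t=0,\dots,H-1).$$ Consequently, if the calibrated parameter $\theta=\hat\theta_N$ satisfies $\mathbb P^N\{V_N\le\varepsilon_{N,s}(\beta)\}\ge1-\beta$, then with probability at least $1-\beta$ over the calibration data $S_N$, $$\mathbb P\{x_{t\mid k}\notin\mathcal X\text{ for some }t\in\{1,\dots,H\}\ \text{ or }\ u_{t\mid k}\notin\mathcal U\text{ for some }t\in\{0,\dots,H-1\}\mid S_N\}\le\varepsilon_{N,s}(\beta).$$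
   Context: System: $x_{k+1}=Ax_k+Bu_k+w_k$, $x_k\in\mathbb R^n$, $u_k\in\mathbb R^m$, $w_k$ random disturbance. $\mathcal X\subset\mathbb R^n$, $\mathcal U\subset\mathbb R^m$ are compact convex constraint sets with the origin in their interiors. $K$ is a fixed gain, $A_K:=A+BK$ (stable). With nominal dynamics $z_{t+1}=Az_t+Bv_t$, actual prediction $x_t=z_t+e_t$ and feedback $u_t=v_t+Ke_t$, the prediction error satisfies $e_{t+1}=A_Ke_t+w_t$, with $e_0=0$ at each MPC epoch (measured-state initialization $z_0=x_k$). Tube: $\mathcal E_\theta\subseteq\mathbb R^{nH}$, $\theta\in\Theta$, measurable. Cross-sections: $\mathcal S_0=\{0\}$, and for $t=1,\dots,H$, $\mathcal S_t=\mathcal S_t(\theta)$ is the projection $\{e_t:\exists(e_1,\dots,e_H)\in\mathcal E_\theta\}$ of $\mathcal E_\theta$ onto its $t$-th block, taken compact and convex (or, if needed, replaced by a compact convex set containing that projection). $\oplus$ is Minkowski sum and $P\ominus Q:=\{a:a+Q\subseteq P\}$. CT-MPC problem at state $x$ (with given stage cost $\ell$, terminal cost $\ell_f$ and terminal set $\mathcal X_f(\theta)$): minimize $\ell_f(z_H)+\sum_{t=0}^{H-1}\ell(z_t,v_t)$ over $(z_0,\dots,z_H)$, $(v_0,\dots,v_{H-1})$ subject to $z_0=x$; $z_{t+1}=Az_t+Bv_t$, $z_t\in\mathcal X\ominus\mathcal S_t$, $v_t\in\mathcal U\ominus K\mathcal S_t$ for $t=0,\dots,H-1$; and $z_H\in\mathcal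 X_f(\theta)$. Sampling assumption: all modelling and tuning choices are fixed before the calibration residual trajectories $S_N=(\mathbf E^1,\dots,\mathbf E^N)$, $\mathbf E^i\in\mathbb R^{nH}$, are used; conditional on this training/tuning information and on the online information pattern (conditioning suppressed in the notation), $\mathbf E^1,\dots,\mathbf E^N$ and any finite number of fresh residual trajectories are i.i.d. The online error trajectory $\mathbf E_k$ is such a fresh trajectory. $\hat\theta_N$ is the tube parameter computed from $S_N$, $V_N:=\mathbb P\{\mathbf E\notin\mathcal E_{\hat\theta_N}\mid S_N\}$ with $\mathbf E$ fresh, $\mathbb P^N$ is the law of $S_N$, $\beta\in(0,1)$, $s\in\{1,\dots,N\}$, $B_{N,s}(\varepsilon):=\sum_{j=0}^{s-1}\binom Nj\varepsilon^j(1-\varepsilon)^{N-j}$ and $\varepsilon_{N,s}(\beta):=\inf\{\varepsilon\in[0,1]:B_{N,s}(\varepsilon)\le\beta\}$. *)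

theory Defs
  imports "HOL-Probability.Probability"
begin

definition schur_stable :: "real ^ 'n ^ 'n \<Rightarrow> bool" where
  "schur_stable M \<longleftrightarrow>
     (\<forall>(\<mu>::complex) (\<xi>::complex ^ 'n).
        \<xi> \<noteq> 0 \<and> map_matrix complex_of_real M *v \<xi> = \<mu> *s \<xi> \<longrightarrow> cmod \<mu> < 1)"

definition constraint_set :: "'a::euclidean_space set \<Rightarrow> bool" where
  "constraint_set P \<longleftrightarrow> compact P \<and> convex P \<and> 0 \<in> interior P"

text \<open>Minkowski sums of sets are written \<open>P + Q\<close>, as in \<^theory>\<open>HOL-Library.Set_Algebras\<close>.\<close>

definition pontryagin_diff :: "'a::ab_group_add set \<Rightarrow> 'a set \<Rightarrow> 'a set"  (infixl "\<ominus>" 65) where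
  "P \<ominus> Q = {a. (\<lambda>q. a + q) ` Q \<subseteq> P}"


section \<open>Closed loop over the horizon\<close>

primrec pred_err ::
  "real ^ 'n ^ 'n \<Rightarrow> real ^ 'm ^ 'n \<Rightarrow> real ^ 'n ^ 'm \<Rightarrow> (nat \<Rightarrow> real ^ 'n) \<Rightarrow> nat \<Rightarrow> real ^ 'n" where
  "pred_err A B K w 0 = 0"
| "pred_err A B K w (Suc t) = (A + B ** K) *v pred_err A B K w t + w t"

definition applied_input ::
  "real ^ 'n ^ 'n \<Rightarrow> real ^ 'm ^ 'n \<Rightarrow> real ^ 'n ^ 'm \<Rightarrow> (nat \<Rightarrow> real ^ 'n) \<Rightarrow> (nat \<Rightarrow> real ^ 'm)
     \<Rightarrow> nat \<Rightarrow> real ^ 'm" where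
  "applied_input A B K w v t = v t + K *v pred_err A B K w t"

text \<open>The true plant started at \<open>x\<close> and driven by the applied inputs; that it equals
  nominal state plus prediction error is a consequence, not part of the definition.\<close>

primrec true_state ::
  "real ^ 'n ^ 'n \<Rightarrow> real ^ 'm ^ 'n \<Rightarrow> real ^ 'n ^ 'm \<Rightarrow> (nat \<Rightarrow> real ^ 'n) \<Rightarrow> (nat \<Rightarrow> real ^ 'm)
     \<Rightarrow> real ^ 'n \<Rightarrow> nat \<Rightarrow> real ^ 'n" where
  "true_state A B K w v x 0 = x"
| "true_state A B K w v x (Suc t) =
     A *v true_state A B K w v x t + B *v applied_input A B K w v t + w t"

text \<open>A trajectory \<open>(e\<^sub>1, \<dots>, e\<^sub>H)\<close> with entries in \<open>\<real>\<^sup>n\<close> is a function on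
  \<open>{1..H}\<close> that is \<open>undefined\<close> elsewhere; the space of these plays the role of
  \<open>\<real>\<^sup>n\<^sup>H\<close> with its Borel sets.\<close>

definition traj_space :: "nat \<Rightarrow> (nat \<Rightarrow> real ^ 'n) measure" where
  "traj_space H = PiM {1..H} (\<lambda>_. borel)"

definition err_traj ::
  "real ^ 'n ^ 'n \<Rightarrow> real ^ 'm ^ 'n \<Rightarrow> real ^ 'n ^ 'm \<Rightarrow> nat \<Rightarrow> (nat \<Rightarrow> real ^ 'n) \<Rightarrow> nat \<Rightarrow> real ^ 'n" where
  "err_traj A B K H w = restrict (pred_err A B K w) {1..H}"


section \<open>Tube cross-sections and the MPC problem\<close>

text \<open>\<open>S t\<close> is the projection of the tube \<open>T\<close> onto block \<open>t\<close>, or a compact convex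
  set containing it. The inclusion covers both cases.\<close>

definition cross_sections :: "nat \<Rightarrow> (nat \<Rightarrow> real ^ 'n) set \<Rightarrow> (nat \<Rightarrow> (real ^ 'n) set) \<Rightarrow> bool" where
  "cross_sections H T S \<longleftrightarrow>
     S 0 = {0} \<and>
     (\<forall>t\<in>{1..H}. (\<lambda>e. e t) ` T \<subseteq> S t \<and> compact (S t) \<and> convex (S t))"

definition mpc_feasible ::
  "real ^ 'n ^ 'n \<Rightarrow> real ^ 'm ^ 'n \<Rightarrow> real ^ 'n ^ 'm \<Rightarrow> (real ^ 'n) set \<Rightarrow> (real ^ 'm) set \<Rightarrow> nat
     \<Rightarrow> (nat \<Rightarrow> (real ^ 'n) set) \<Rightarrow> (real ^ 'n) set \<Rightarrow> real ^ 'n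
     \<Rightarrow> (nat \<Rightarrow> real ^ 'n) \<Rightarrow> (nat \<Rightarrow> real ^ 'm) \<Rightarrow> bool" where
  "mpc_feasible A B K X U H S Xf x z v \<longleftrightarrow>
     z 0 = x \<and>
     (\<forall>t<H. z (Suc t) = A *v z t + B *v v t \<and>
            z t \<in> X \<ominus> S t \<and>
            v t \<in> U \<ominus> ((\<lambda>e. K *v e) ` S t)) \<and>
     z H \<in> Xf"

definition mpc_cost ::
  "nat \<Rightarrow> (real ^ 'n \<Rightarrow> real ^ 'm \<Rightarrow> real) \<Rightarrow> (real ^ 'n \<Rightarrow> real)
     \<Rightarrow> (nat \<Rightarrow> real ^ 'n) \<Rightarrow> (nat \<Rightarrow> real ^ 'm) \<Rightarrow> real" where
  "mpc_cost H l lf z v = lf (z H) + (\<Sum>t<H. l (z t) (v t))"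

definition mpc_optimal ::
  "real ^ 'n ^ 'n \<Rightarrow> real ^ 'm ^ 'n \<Rightarrow> real ^ 'n ^ 'm \<Rightarrow> (real ^ 'n) set \<Rightarrow> (real ^ 'm) set \<Rightarrow> nat
     \<Rightarrow> (real ^ 'n \<Rightarrow> real ^ 'm \<Rightarrow> real) \<Rightarrow> (real ^ 'n \<Rightarrow> real)
     \<Rightarrow> (nat \<Rightarrow> (real ^ 'n) set) \<Rightarrow> (real ^ 'n) set \<Rightarrow> real ^ 'n
     \<Rightarrow> (nat \<Rightarrow> real ^ 'n) \<Rightarrow> (nat \<Rightarrow> real ^ 'm) \<Rightarrow> bool" where
  "mpc_optimal A B K X U H l lf S Xf x z v \<longleftrightarrow>
     mpc_feasible A B K X U H S Xf x z v \<and>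
     (\<forall>z' v'. mpc_feasible A B K X U H S Xf x z' v' \<longrightarrow> mpc_cost H l lf z v \<le> mpc_cost H l lf z' v')"


section \<open>Calibration data and conditional probabilities\<close>

text \<open>The measure \<open>M\<close> is the probability law after conditioning on the training/tuning
  information and the online information pattern. Trajectories \<open>1, \<dots>, N\<close> are the
  calibration data, all later indices are fresh. Independence of the infinite family means
  independence of all its finite subfamilies.\<close>

definition iid_residuals :: "'w measure \<Rightarrow> nat \<Rightarrow> (nat \<Rightarrow> 'w \<Rightarrow> nat \<Rightarrow> real ^ 'n) \<Rightarrow> bool" where
  "iid_residuals M H E \<longleftrightarrow>
     prob_space M \<and>
     prob_space.indep_vars M (\<lambda>_. traj_space H) E {1..} \<and>
     (\<forall>i\<ge>1. distr M (traj_space H) (E i) = distr M (traj_space H) (E 1))"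

definition sample_space :: "nat \<Rightarrow> nat \<Rightarrow> (nat \<Rightarrow> nat \<Rightarrow> real ^ 'n) measure" where
  "sample_space N H = PiM {1..N} (\<lambda>_. traj_space H)"

definition sample :: "nat \<Rightarrow> (nat \<Rightarrow> 'w \<Rightarrow> nat \<Rightarrow> real ^ 'n) \<Rightarrow> 'w \<Rightarrow> nat \<Rightarrow> nat \<Rightarrow> real ^ 'n" where
  "sample N E \<omega> = (\<lambda>i\<in>{1..N}. E i \<omega>)"

text \<open>The conditional probability of the event \<open>P\<close> given the \<open>\<sigma>\<close>-algebra generated by
  the random variable \<open>Y\<close> with values in the measurable space \<open>MY\<close>. It is a
  \<open>\<sigma>(Y)\<close>-measurable function, so the \<open>M\<close>-probability that it stays below
  a level is a probability under the law of \<open>Y\<close>.\<close>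

definition cond_prob_given ::
  "'w measure \<Rightarrow> 'y measure \<Rightarrow> ('w \<Rightarrow> 'y) \<Rightarrow> ('w \<Rightarrow> bool) \<Rightarrow> 'w \<Rightarrow> real" where
  "cond_prob_given M MY Y P =
     real_cond_exp M (vimage_algebra (space M) Y MY) (indicator {\<omega> \<in> space M. P \<omega>})"

definition binom_tail :: "nat \<Rightarrow> nat \<Rightarrow> real \<Rightarrow> real" where
  "binom_tail N s \<epsilon> = (\<Sum>j<s. real (N choose j) * \<epsilon> ^ j * (1 - \<epsilon>) ^ (N - j))"

definition eps_bound :: "nat \<Rightarrow> nat \<Rightarrow> real \<Rightarrow> real" where
  "eps_bound N s \<beta> = Inf {\<epsilon> \<in> {0..1}. binom_tail N s \<epsilon> \<le> \<beta>}"

end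

theory Submission
  imports Defs
begin

text \<open>Along the closed loop the true state is the nominal state plus the prediction error, so the
  tightened constraints give the deterministic claim. The violation event is therefore almost surely
  contained in the event that the online trajectory leaves the calibrated tube. Every fresh
  trajectory has the same joint law with the calibration data, so the online trajectory may be
  exchanged for the one defining \<open>V\<^sub>N\<close> without changing the conditional probability.\<close>

section \<open>Deterministic constraint satisfaction inside the tube\<close>

lemma pontryagin_diffD: "a \<in> P \<ominus> Q \<Longrightarrow> q \<in> Q \<Longrightarrow> a + q \<in> P"
  by (auto simp: pontryagin_diff_def)

text \<open>Substituting \<open>z + e\<close> for the state and \<open>v + K e\<close> for the input
  splits one plant step into the nominal step \<open>A z + B v\<close> and the error step
  \<open>(A + B K) e + w\<close>. Both start correctly because the error at time 0 is 0.\<close>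

lemma true_state_eq_nominal_plus_error:
  assumes "z 0 = x" and "\<And>t. t < H \<Longrightarrow> z (Suc t) = A *v z t + B *v v t" and "t \<le> H"
  shows "true_state A B K w v x t = z t + pred_err A B K w t"
  using assms(3)
proof (induction t)
  case 0
  then show ?case using assms(1) by simp
next
  case (Suc t)
  then show ?case
    using assms(2)[of t]
    by (simp add: applied_input_def matrix_vector_right_distrib matrix_vector_mult_add_rdistrib
        matrix_vector_mul_assoc add_ac)
qed

lemma constraints_satisfied_in_tube:
  assumes cs: "cross_sections H T S" and terminal: "Xf + S H \<subseteq> X"
    and feas: "mpc_feasible A B K X U H S Xf x z v"
    and tube: "err_traj A B K H w \<in> T"
  shows "t \<in> {1..H} \<Longrightarrow> true_state A B K w v x t \<in> X"
    and "t < H \<Longrightarrow> applied_input A B K w v t \<in> U"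
proof -
  \<comment> \<open>The tube controls only the blocks from 1 on; at time 0 the membership comes from
    \<open>S 0 = {0}\<close> and the zero initial error.\<close>
  have err: "pred_err A B K w t \<in> S t" if "t \<le> H" for t
  proof (cases t)
    case 0
    then show ?thesis using cs by (simp add: cross_sections_def)
  next
    case (Suc k)
    then have "t \<in> {1..H}" using that by simp
    moreover from this have "(\<lambda>e. e t) ` T \<subseteq> S t"
      using cs by (simp add: cross_sections_def)
    ultimately show ?thesis using tube by (force simp: err_traj_def)
  qed
  have state: "true_state A B K w v x t = z t + pred_err A B K w t" if "t \<le> H" for t
    by (rule true_state_eq_nominal_plus_error[OF _ _ that])
      (use feas in \<open>auto simp: mpc_feasible_def\<close>)
  show "true_state A B K w v x t \<in> X" if "t \<in> {1..H}"
  \<comment> \<open>The tightened state constraints of the MPC problem stop at \<open>H - 1\<close>.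
    At \<open>H\<close> the nominal state is only known to lie in the terminal set, and the
    inclusion \<open>Xf + S H \<subseteq> X\<close> takes over.\<close>
  proof (cases "t = H")
    case True
    have "z H \<in> Xf" using feas by (simp add: mpc_feasible_def)
    then have "z H + pred_err A B K w H \<in> Xf + S H"
      using err[of H] by (intro set_plus_intro) auto
    then show ?thesis using True state[of H] terminal by auto
  next
    case False
    then have "t < H" using that by simp
    then have "z t \<in> X \<ominus> S t" using feas by (simp add: mpc_feasible_def)
    then show ?thesis
      using pontryagin_diffD err[of t] state[of t] \<open>t < H\<close> by fastforce
  qed
  show "applied_input A B K w v t \<in> U" if "t < H"
  proof -
    \<comment> \<open>The input deviates from \<open>v t\<close> by \<open>K\<close> times the
      error, which is why the input set is tightened by the image of \<open>S t\<close> under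
      \<open>K\<close>.\<close>
    have "v t \<in> U \<ominus> ((\<lambda>e. K *v e) ` S t)"
      using feas that by (simp add: mpc_feasible_def)
    then show ?thesis
      unfolding applied_input_def using err[of t] that by (intro pontryagin_diffD) auto
  qed
qed

section \<open>Measurability of the closed loop\<close>

lemma borel_measurable_matrix_vector_mult [measurable (raw)]:
  fixes A :: "real ^ 'n ^ 'm"
  assumes "f \<in> borel_measurable M"
  shows "(\<lambda>\<omega>. A *v f \<omega>) \<in> borel_measurable M"
  using assms
  by (intro borel_measurable_continuous_on[of "\<lambda>x. A *v x"] linear_continuous_on)
    (auto simp: matrix_vector_mul_bounded_linear)

text \<open>The error at time \<open>t\<close> is built from the disturbances strictly before
  \<open>t\<close>, so disturbances with index below \<open>H\<close> suffice up to and including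
  time \<open>H\<close>.\<close>

lemma borel_measurable_pred_err:
  assumes W: "\<And>t. t < H \<Longrightarrow> (\<lambda>\<omega>. W \<omega> t) \<in> borel_measurable M" and "t \<le> H"
  shows "(\<lambda>\<omega>. pred_err A B K (W \<omega>) t) \<in> borel_measurable M"
  using assms(2)
proof (induction t)
  case (Suc t)
  then show ?case using W[of t] by simp measurable
qed simp

lemma borel_measurable_applied_input:
  assumes W: "\<And>t. t < H \<Longrightarrow> (\<lambda>\<omega>. W \<omega> t) \<in> borel_measurable M"
    and v: "\<And>t. t < H \<Longrightarrow> (\<lambda>\<omega>. v \<omega> t) \<in> borel_measurable M" and "t < H"
  shows "(\<lambda>\<omega>. applied_input A B K (W \<omega>) (v \<omega>) t) \<in> borel_measurable M"
proof -
  have [measurable]: "(\<lambda>\<omega>. pred_err A B K (W \<omega>) t) \<in> borel_measurable M"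
    using borel_measurable_pred_err[of H W M t] W \<open>t < H\<close> by simp
  have [measurable]: "(\<lambda>\<omega>. v \<omega> t) \<in> borel_measurable M" using v \<open>t < H\<close> .
  show ?thesis unfolding applied_input_def by measurable
qed

lemma borel_measurable_true_state:
  assumes W: "\<And>t. t < H \<Longrightarrow> (\<lambda>\<omega>. W \<omega> t) \<in> borel_measurable M"
    and v: "\<And>t. t < H \<Longrightarrow> (\<lambda>\<omega>. v \<omega> t) \<in> borel_measurable M"
    and x: "x \<in> borel_measurable M" and "t \<le> H"
  shows "(\<lambda>\<omega>. true_state A B K (W \<omega>) (v \<omega>) (x \<omega>) t) \<in> borel_measurable M"
  using \<open>t \<le> H\<close>
proof (induction t)
  case 0
  then show ?case using x by simp
next
  case (Suc t)
  have [measurable]: "(\<lambda>\<omega>. applied_input A B K (W \<omega>) (v \<omega>) t) \<in> borel_measurable M"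
    by (rule borel_measurable_applied_input[of H]) (use W v Suc in auto)
  show ?case using Suc W[of t] by simp measurable
qed

text \<open>Closed sets are Borel and the horizon is finite, so the violation event is a finite
  union of measurable events. This makes its indicator integrable, as the comparison of conditional
  probabilities requires.\<close>

lemma violation_event_measurable:
  assumes "closed X" "closed U"
    and W: "\<And>t. t < H \<Longrightarrow> (\<lambda>\<omega>. W \<omega> t) \<in> borel_measurable M"
    and v: "\<And>t. t < H \<Longrightarrow> (\<lambda>\<omega>. v \<omega> t) \<in> borel_measurable M"
    and x: "x \<in> borel_measurable M"
  shows "{\<omega> \<in> space M. (\<exists>t\<in>{1..H}. true_state A B K (W \<omega>) (v \<omega>) (x \<omega>) t \<notin> X) \<or>
                        (\<exists>t<H. applied_input A B K (W \<omega>) (v \<omega>) t \<notin> U)} \<in> sets M"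
proof -
  have [measurable]: "X \<in> sets borel" "U \<in> sets borel" using assms(1,2) by auto
  have "{\<omega> \<in> space M. true_state A B K (W \<omega>) (v \<omega>) (x \<omega>) t \<notin> X} \<in> sets M" if "t \<in> {1..H}" for t
  proof -
    have [measurable]: "(\<lambda>\<omega>. true_state A B K (W \<omega>) (v \<omega>) (x \<omega>) t) \<in> borel_measurable M"
      by (rule borel_measurable_true_state[of H]) (use W v x that in auto)
    show ?thesis by measurable
  qed
  moreover have "{\<omega> \<in> space M. applied_input A B K (W \<omega>) (v \<omega>) t \<notin> U} \<in> sets M"
    if "t \<in> {..<H}" for t
  proof -
    have [measurable]: "(\<lambda>\<omega>. applied_input A B K (W \<omega>) (v \<omega>) t) \<in> borel_measurable M"
      by (rule borel_measurable_applied_input[of H]) (use W v that in auto)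
    show ?thesis by measurable
  qed
  \<comment> \<open>The input index is put into the finite set \<open>{..<H}\<close> so that the
    rule for finite existential quantifiers applies; unfolding \<open>Bex\<close> then restores the
    form with \<open>t < H\<close>.\<close>
  ultimately have "{\<omega> \<in> space M. (\<exists>t\<in>{1..H}. true_state A B K (W \<omega>) (v \<omega>) (x \<omega>) t \<notin> X) \<or>
      (\<exists>t\<in>{..<H}. applied_input A B K (W \<omega>) (v \<omega>) t \<notin> U)} \<in> sets M"
    by (intro sets.sets_Collect_disj sets.sets_Collect_finite_Ex) auto
  then show ?thesis by (simp only: Bex_def lessThan_iff)
qed

section \<open>Conditional probabilities given a random variable\<close>

lemma (in prob_space) subalgebra_vimage_algebra:
  assumes "Y \<in> M \<rightarrow>\<^sub>M MY"
  shows "subalgebra M (vimage_algebra (space M) Y MY)"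
  using assms by (auto simp: subalgebra_def sets_vimage_algebra2 measurable_space)

lemma (in prob_space) finite_measure_subalgebra_vimage_algebra:
  assumes "Y \<in> M \<rightarrow>\<^sub>M MY"
  shows "finite_measure_subalgebra M (vimage_algebra (space M) Y MY)"
  using subalgebra_vimage_algebra[OF assms]
  by (simp add: finite_measure_subalgebra_def finite_measure_subalgebra_axioms_def
      finite_measure_axioms)

lemma (in prob_space) borel_measurable_cond_prob_given:
  assumes "Y \<in> M \<rightarrow>\<^sub>M MY"
  shows "cond_prob_given M MY Y P \<in> borel_measurable M"
proof -
  interpret F: finite_measure_subalgebra M "vimage_algebra (space M) Y MY"
    by (rule finite_measure_subalgebra_vimage_algebra[OF assms])
  show ?thesis unfolding cond_prob_given_def by simp
qed

lemma (in prob_space) cond_prob_given_mono_AE: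
  assumes Y: "Y \<in> M \<rightarrow>\<^sub>M MY"
    and P: "{\<omega> \<in> space M. P \<omega>} \<in> events" and Q: "{\<omega> \<in> space M. Q \<omega>} \<in> events"
    and imp: "AE \<omega> in M. P \<omega> \<longrightarrow> Q \<omega>"
  shows "AE \<omega> in M. cond_prob_given M MY Y P \<omega> \<le> cond_prob_given M MY Y Q \<omega>"
proof -
  interpret F: finite_measure_subalgebra M "vimage_algebra (space M) Y MY"
    by (rule finite_measure_subalgebra_vimage_algebra[OF Y])
  show ?thesis
    unfolding cond_prob_given_def
    by (rule F.real_cond_exp_mono)
      (use imp P Q in \<open>auto simp: integrable_indicator_iff emeasure_eq_measure indicator_def\<close>)
qed

lemma (in prob_space) cond_prob_given_cong_joint_law:
  assumes Y: "Y \<in> M \<rightarrow>\<^sub>M MY" and Z: "Z \<in> M \<rightarrow>\<^sub>M MZ" and Z': "Z' \<in> M \<rightarrow>\<^sub>M MZ"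
    and law: "distr M (MY \<Otimes>\<^sub>M MZ) (\<lambda>\<omega>. (Y \<omega>, Z \<omega>)) = distr M (MY \<Otimes>\<^sub>M MZ) (\<lambda>\<omega>. (Y \<omega>, Z' \<omega>))"
    and C: "{c \<in> space (MY \<Otimes>\<^sub>M MZ). R (fst c) (snd c)} \<in> sets (MY \<Otimes>\<^sub>M MZ)"
  shows "AE \<omega> in M. cond_prob_given M MY Y (\<lambda>\<omega>. R (Y \<omega>) (Z \<omega>)) \<omega>
                  = cond_prob_given M MY Y (\<lambda>\<omega>. R (Y \<omega>) (Z' \<omega>)) \<omega>"
proof -
  let ?F = "vimage_algebra (space M) Y MY"
  let ?C = "{c \<in> space (MY \<Otimes>\<^sub>M MZ). R (fst c) (snd c)}"
  let ?P = "\<lambda>V. {\<omega> \<in> space M. R (Y \<omega>) (V \<omega>)}"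
  interpret F: finite_measure_subalgebra M ?F
    by (rule finite_measure_subalgebra_vimage_algebra[OF Y])
  have meas: "(\<lambda>\<omega>. (Y \<omega>, V \<omega>)) \<in> M \<rightarrow>\<^sub>M MY \<Otimes>\<^sub>M MZ" if "V \<in> M \<rightarrow>\<^sub>M MZ" for V
    using Y that by measurable
  have vim: "?P V = (\<lambda>\<omega>. (Y \<omega>, V \<omega>)) -` ?C \<inter> space M" if "V \<in> M \<rightarrow>\<^sub>M MZ" for V
    using measurable_space[OF Y] measurable_space[OF that] by (auto simp: space_pair_measure)
  have ev: "?P V \<in> events" if "V \<in> M \<rightarrow>\<^sub>M MZ" for V
    unfolding vim[OF that] by (rule measurable_sets[OF meas[OF that] C])
  have int: "integrable M (indicator (?P V) :: 'a \<Rightarrow> real)" if "V \<in> M \<rightarrow>\<^sub>M MZ" for V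
    using ev[OF that] by (simp add: integrable_indicator_iff emeasure_eq_measure)
  have "AE \<omega> in M. real_cond_exp M ?F (indicator (?P Z)) \<omega> = real_cond_exp M ?F (indicator (?P Z')) \<omega>"
  \<comment> \<open>By the defining property, it suffices that the conditional expectation formed
    with \<open>Z'\<close> has the same integral as the indicator formed with \<open>Z\<close> over
    every set of the sub-algebra.\<close>
  proof (rule F.real_cond_exp_charact)
    fix G assume G: "G \<in> sets ?F"
    then obtain D where D: "D \<in> sets MY" and G_eq: "G = Y -` D \<inter> space M"
      using measurable_space[OF Y] by (auto simp: sets_vimage_algebra2)
    have G': "G \<in> events" using G F.subalg by (auto simp: subalgebra_def)
    have DC: "?C \<inter> (D \<times> space MZ) \<in> sets (MY \<Otimes>\<^sub>M MZ)"
      using C D by auto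
    have eq: "(LINT \<omega>:G|M. indicator (?P V) \<omega>)
        = measure (distr M (MY \<Otimes>\<^sub>M MZ) (\<lambda>\<omega>. (Y \<omega>, V \<omega>))) (?C \<inter> (D \<times> space MZ))"
      if V: "V \<in> M \<rightarrow>\<^sub>M MZ" for V
    proof -
      have "(LINT \<omega>:G|M. indicator (?P V) \<omega>) = (LINT \<omega>|M. indicator (G \<inter> ?P V) \<omega> :: real)"
        by (simp add: set_lebesgue_integral_def indicator_inter_arith)
      also have "\<dots> = prob (G \<inter> ?P V)"
        using G' ev[OF V] by (simp add: measure_def)
      also have "G \<inter> ?P V = (\<lambda>\<omega>. (Y \<omega>, V \<omega>)) -` (?C \<inter> (D \<times> space MZ)) \<inter> space M"
        using measurable_space[OF Y] measurable_space[OF V]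
        by (auto simp: G_eq space_pair_measure)
      finally show ?thesis
        using measure_distr[OF meas[OF V] DC] by simp
    qed
    have "(LINT \<omega>:G|M. indicator (?P Z) \<omega>) = (LINT \<omega>:G|M. indicator (?P Z') \<omega> :: real)"
      using eq[OF Z] eq[OF Z'] law by simp
    also have "\<dots> = (LINT \<omega>:G|M. real_cond_exp M ?F (indicator (?P Z')) \<omega>)"
      by (rule F.real_cond_exp_intA[OF int[OF Z'] G])
    finally show "(LINT \<omega>:G|M. indicator (?P Z) \<omega>)
        = (LINT \<omega>:G|M. real_cond_exp M ?F (indicator (?P Z')) \<omega>)" .
  qed (use int Z Z' F.real_cond_exp_int(1) in auto)
  then show ?thesis unfolding cond_prob_given_def .
qed

section \<open>Joint law of the calibration data and a fresh trajectory\<close>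

lemma iid_residuals_measurable:
  assumes "iid_residuals M H E" and "i \<ge> 1"
  shows "E i \<in> M \<rightarrow>\<^sub>M traj_space H"
proof -
  interpret prob_space M using assms by (simp add: iid_residuals_def)
  show ?thesis using assms by (auto simp: iid_residuals_def indep_vars_def)
qed

lemma sample_measurable:
  assumes "iid_residuals M H E"
  shows "sample N E \<in> M \<rightarrow>\<^sub>M sample_space N H"
  unfolding sample_def[abs_def] sample_space_def
  by (rule measurable_restrict) (use iid_residuals_measurable[OF assms] in auto)

text \<open>Independence of the index blocks \<open>{1..N}\<close> and \<open>{p}\<close> gives a
  product law, and identical distribution replaces the second factor by the law of
  \<open>E 1\<close>. The right-hand side no longer mentions \<open>p\<close>, so any two fresh
  indices have the same joint law with the sample.\<close>

lemma iid_residuals_joint_law: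
  fixes E :: "nat \<Rightarrow> 'a \<Rightarrow> nat \<Rightarrow> real ^ 'b"
  assumes iid: "iid_residuals M H E" and p: "p > N"
  shows "distr M (sample_space N H \<Otimes>\<^sub>M traj_space H) (\<lambda>\<omega>. (sample N E \<omega>, E p \<omega>))
    = distr M (sample_space N H) (sample N E) \<Otimes>\<^sub>M distr M (traj_space H) (E 1)"
proof -
  interpret prob_space M using iid by (simp add: iid_residuals_def)
  have "indep_vars (\<lambda>_. traj_space H) E {1..}"
    using iid by (simp add: iid_residuals_def)
  then have "indep_vars (\<lambda>_. traj_space H) E ({1..N} \<union> {p})"
    by (rule indep_vars_subset) (use p in auto)
  then have "indep_var (PiM {1..N} (\<lambda>_. traj_space H)) (\<lambda>\<omega>. \<lambda>i\<in>{1..N}. E i \<omega>)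
      (PiM {p} (\<lambda>_. traj_space H)) (\<lambda>\<omega>. \<lambda>i\<in>{p}. E i \<omega>)"
    by (rule indep_var_restrict) (use p in auto)
  moreover have Mp: "(\<lambda>\<omega>. \<lambda>i\<in>{p}. E i \<omega>) \<in> M \<rightarrow>\<^sub>M PiM {p} (\<lambda>_. traj_space H)"
    by (rule measurable_restrict) (use iid_residuals_measurable[OF iid] p in auto)
  moreover have Y: "sample N E \<in> M \<rightarrow>\<^sub>M sample_space N H"
    by (rule sample_measurable[OF iid])
  ultimately have prod: "distr M (sample_space N H \<Otimes>\<^sub>M PiM {p} (\<lambda>_. traj_space H))
        (\<lambda>\<omega>. (sample N E \<omega>, \<lambda>i\<in>{p}. E i \<omega>))
      = distr M (sample_space N H) (sample N E)
        \<Otimes>\<^sub>M distr M (PiM {p} (\<lambda>_. traj_space H)) (\<lambda>\<omega>. \<lambda>i\<in>{p}. E i \<omega>)"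
    by (simp add: indep_var_distribution_eq sample_space_def sample_def[abs_def])
  \<comment> \<open>Block independence delivers the fresh trajectory as a function on the singleton
    \<open>{p}\<close>. Evaluation at \<open>p\<close> strips this wrapper, and pushing the product
    law forward along it yields the wanted pair.\<close>
  have proj: "(\<lambda>f. f p) \<in> PiM {p} (\<lambda>_. traj_space H) \<rightarrow>\<^sub>M (traj_space H :: (nat \<Rightarrow> real ^ 'b) measure)"
    by (rule measurable_component_singleton) simp
  have pair: "(\<lambda>(x, f). (x, f p)) \<in> sample_space N H \<Otimes>\<^sub>M PiM {p} (\<lambda>_. traj_space H)
      \<rightarrow>\<^sub>M sample_space N H \<Otimes>\<^sub>M (traj_space H :: (nat \<Rightarrow> real ^ 'b) measure)"
    using proj by measurable
  have Ep: "distr M (traj_space H) (E p)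
      = distr (distr M (PiM {p} (\<lambda>_. traj_space H)) (\<lambda>\<omega>. \<lambda>i\<in>{p}. E i \<omega>)) (traj_space H) (\<lambda>f. f p)"
    by (simp add: distr_distr[OF proj Mp] comp_def)
  have "distr M (traj_space H) (E 1) = distr M (traj_space H) (E p)"
    using iid p unfolding iid_residuals_def
    by (metis One_nat_def Suc_leI gr_zeroI less_nat_zero_code)
  \<comment> \<open>Being a probability law, the second factor is sigma-finite, a side condition of
    \<open>pair_measure_distr\<close>.\<close>
  moreover have "prob_space (distr M (traj_space H) (E p))"
    by (rule prob_space_distr) (use iid_residuals_measurable[OF iid] p in auto)
  \<comment> \<open>The first factor is written as its image under the identity, so that the product
    of two image measures becomes the image of a product.\<close>
  ultimately have "distr M (sample_space N H) (sample N E) \<Otimes>\<^sub>M distr M (traj_space H) (E 1)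
      = distr (distr M (sample_space N H) (sample N E)) (sample_space N H) (\<lambda>x. x)
        \<Otimes>\<^sub>M distr (distr M (PiM {p} (\<lambda>_. traj_space H)) (\<lambda>\<omega>. \<lambda>i\<in>{p}. E i \<omega>)) (traj_space H) (\<lambda>f. f p)"
    by (simp add: Ep distr_distr[OF _ Y] comp_def)
  also have "\<dots> = distr (distr M (sample_space N H \<Otimes>\<^sub>M PiM {p} (\<lambda>_. traj_space H))
        (\<lambda>\<omega>. (sample N E \<omega>, \<lambda>i\<in>{p}. E i \<omega>))) (sample_space N H \<Otimes>\<^sub>M traj_space H)
        (\<lambda>(x, f). (x, f p))"
    unfolding prod
    by (rule pair_measure_distr)
      (use proj Ep \<open>prob_space (distr M (traj_space H) (E p))\<close> in
        \<open>auto simp: prob_space_imp_sigma_finite\<close>)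
  also have "\<dots> = distr M (sample_space N H \<Otimes>\<^sub>M traj_space H) (\<lambda>\<omega>. (sample N E \<omega>, E p \<omega>))"
    using Y Mp by (subst distr_distr[OF pair]) (auto simp: comp_def)
  finally show ?thesis ..
qed

section \<open>Deterministic implication and transfer of the calibration bound\<close>

theorem theorem10:
  fixes A :: "real ^ 'n ^ 'n" and B :: "real ^ 'm ^ 'n" and K :: "real ^ 'n ^ 'm"
    and X :: "(real ^ 'n) set" and U :: "(real ^ 'm) set"
    and H :: nat
    and l :: "real ^ 'n \<Rightarrow> real ^ 'm \<Rightarrow> real" and lf :: "real ^ 'n \<Rightarrow> real"
    and \<Theta> :: "'p set"
    and Tube :: "'p \<Rightarrow> (nat \<Rightarrow> real ^ 'n) set"
    and S :: "'p \<Rightarrow> nat \<Rightarrow> (real ^ 'n) set"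
    and Xf :: "'p \<Rightarrow> (real ^ 'n) set"
    and M :: "'w measure"
    and E :: "nat \<Rightarrow> 'w \<Rightarrow> nat \<Rightarrow> real ^ 'n"
  assumes X: "constraint_set X" and U: "constraint_set U"
    and stable: "schur_stable (A + B ** K)"
    and tube_meas: "\<forall>\<theta>\<in>\<Theta>. Tube \<theta> \<in> sets (traj_space H)"
    and cross: "\<forall>\<theta>\<in>\<Theta>. cross_sections H (Tube \<theta>) (S \<theta>)"
    and iid: "iid_residuals M H E"
  shows
    "(\<forall>\<theta>\<in>\<Theta>. \<forall>xk z v w.
       Xf \<theta> + S \<theta> H \<subseteq> X \<longrightarrow>
       mpc_optimal A B K X U H l lf (S \<theta>) (Xf \<theta>) xk z v \<longrightarrow>
       err_traj A B K H w \<in> Tube \<theta> \<longrightarrow>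
         (\<forall>t\<in>{1..H}. true_state A B K w v xk t \<in> X) \<and>
         (\<forall>t<H. applied_input A B K w v t \<in> U))
     \<and>
     (\<forall>(N::nat) (s::nat) (\<beta>::real)
        (\<theta>hat :: (nat \<Rightarrow> nat \<Rightarrow> real ^ 'n) \<Rightarrow> 'p) (p::nat) (q::nat)
        (W :: 'w \<Rightarrow> nat \<Rightarrow> real ^ 'n) (xk :: 'w \<Rightarrow> real ^ 'n)
        (z :: 'w \<Rightarrow> nat \<Rightarrow> real ^ 'n) (v :: 'w \<Rightarrow> nat \<Rightarrow> real ^ 'm).
       0 < \<beta> \<and> \<beta> < 1 \<and> s \<in> {1..N} \<longrightarrow>
       \<comment> \<open>the calibrated parameter, a function of the calibration data\<close>
       (\<forall>D\<in>space (sample_space N H). \<theta>hat D \<in> \<Theta>) \<longrightarrow>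
       {De \<in> space (sample_space N H \<Otimes>\<^sub>M traj_space H). snd De \<in> Tube (\<theta>hat (fst De))}
         \<in> sets (sample_space N H \<Otimes>\<^sub>M traj_space H) \<longrightarrow>
       \<comment> \<open>\<open>E p\<close> is the fresh trajectory defining \<open>V\<^sub>N\<close>; \<open>E q\<close> is the online one\<close>
       p > N \<longrightarrow> q > N \<longrightarrow>
       (\<forall>\<omega>\<in>space M. E q \<omega> = err_traj A B K H (W \<omega>)) \<longrightarrow>
       (\<forall>t<H. (\<lambda>\<omega>. W \<omega> t) \<in> borel_measurable M) \<longrightarrow>
       xk \<in> borel_measurable M \<longrightarrow>
       (\<forall>t<H. (\<lambda>\<omega>. v \<omega> t) \<in> borel_measurable M) \<longrightarrow>
       (AE \<omega> in M. Xf (\<theta>hat (sample N E \<omega>)) + S (\<theta>hat (sample N E \<omega>)) H \<subseteq> X) \<longrightarrow>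
       (AE \<omega> in M. mpc_optimal A B K X U H l lf
         (S (\<theta>hat (sample N E \<omega>))) (Xf (\<theta>hat (sample N E \<omega>))) (xk \<omega>) (z \<omega>) (v \<omega>)) \<longrightarrow>
       \<P>(\<omega> in M. cond_prob_given M (sample_space N H) (sample N E)
                    (\<lambda>\<omega>'. E p \<omega>' \<notin> Tube (\<theta>hat (sample N E \<omega>'))) \<omega>
                  \<le> eps_bound N s \<beta>) \<ge> 1 - \<beta> \<longrightarrow>
       \<P>(\<omega> in M. cond_prob_given M (sample_space N H) (sample N E)
                    (\<lambda>\<omega>'. (\<exists>t\<in>{1..H}. true_state A B K (W \<omega>') (v \<omega>') (xk \<omega>') t \<notin> X) \<or>
                          (\<exists>t<H. applied_input A B K (W \<omega>') (v \<omega>') t \<notin> U)) \<omega>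
                  \<le> eps_bound N s \<beta>) \<ge> 1 - \<beta>)"
proof (intro conjI allI ballI impI)
  fix \<theta> xk z v w t
  assume th: "\<theta> \<in> \<Theta>" and *: "Xf \<theta> + S \<theta> H \<subseteq> X"
    "mpc_optimal A B K X U H l lf (S \<theta>) (Xf \<theta>) xk z v" "err_traj A B K H w \<in> Tube \<theta>"
  then have "mpc_feasible A B K X U H (S \<theta>) (Xf \<theta>) xk z v"
    by (simp add: mpc_optimal_def)
  note sat = constraints_satisfied_in_tube[OF cross[rule_format, OF th] *(1) this *(3)]
  show "true_state A B K w v xk t \<in> X" if "t \<in> {1..H}"
    using sat(1) that .
  show "applied_input A B K w v t \<in> U" if "t < H"
    using sat(2) that .
next
  fix N s :: nat and \<beta> :: real and \<theta>hat :: "(nat \<Rightarrow> nat \<Rightarrow> real ^ 'n) \<Rightarrow> 'p" and p q :: nat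
    and W :: "'w \<Rightarrow> nat \<Rightarrow> real ^ 'n" and xk :: "'w \<Rightarrow> real ^ 'n"
    and z :: "'w \<Rightarrow> nat \<Rightarrow> real ^ 'n" and v :: "'w \<Rightarrow> nat \<Rightarrow> real ^ 'm"
  let ?Y = "sample N E" and ?MY = "sample_space N H" and ?MZ = "traj_space H :: (nat \<Rightarrow> real ^ 'n) measure"
  let ?out = "\<lambda>i \<omega>. E i \<omega> \<notin> Tube (\<theta>hat (?Y \<omega>))"
  let ?bad = "\<lambda>\<omega>. (\<exists>t\<in>{1..H}. true_state A B K (W \<omega>) (v \<omega>) (xk \<omega>) t \<notin> X) \<or>
                   (\<exists>t<H. applied_input A B K (W \<omega>) (v \<omega>) t \<notin> U)"
  let ?c = "cond_prob_given M ?MY ?Y"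
  assume th: "\<forall>D\<in>space ?MY. \<theta>hat D \<in> \<Theta>"
    and C: "{De \<in> space (?MY \<Otimes>\<^sub>M ?MZ). snd De \<in> Tube (\<theta>hat (fst De))} \<in> sets (?MY \<Otimes>\<^sub>M ?MZ)"
    and p: "p > N" and q: "q > N"
    and online: "\<forall>\<omega>\<in>space M. E q \<omega> = err_traj A B K H (W \<omega>)"
    and W: "\<forall>t<H. (\<lambda>\<omega>. W \<omega> t) \<in> borel_measurable M"
    and xk: "xk \<in> borel_measurable M"
    and v: "\<forall>t<H. (\<lambda>\<omega>. v \<omega> t) \<in> borel_measurable M"
    and terminal: "AE \<omega> in M. Xf (\<theta>hat (?Y \<omega>)) + S (\<theta>hat (?Y \<omega>)) H \<subseteq> X"
    and opt: "AE \<omega> in M. mpc_optimal A B K X U H l lf (S (\<theta>hat (?Y \<omega>))) (Xf (\<theta>hat (?Y \<omega>)))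
       (xk \<omega>) (z \<omega>) (v \<omega>)"
    and cal: "\<P>(\<omega> in M. ?c (?out p) \<omega> \<le> eps_bound N s \<beta>) \<ge> 1 - \<beta>"
  interpret prob_space M using iid by (simp add: iid_residuals_def)
  have Y: "?Y \<in> M \<rightarrow>\<^sub>M ?MY" by (rule sample_measurable[OF iid])
  have Ep: "E p \<in> M \<rightarrow>\<^sub>M ?MZ" and Eq: "E q \<in> M \<rightarrow>\<^sub>M ?MZ"
    using iid_residuals_measurable[OF iid] p q by auto
  have C': "{De \<in> space (?MY \<Otimes>\<^sub>M ?MZ). snd De \<notin> Tube (\<theta>hat (fst De))} \<in> sets (?MY \<Otimes>\<^sub>M ?MZ)"
    using C by (rule sets.sets_Collect_neg)
  \<comment> \<open>Both \<open>p\<close> and \<open>q\<close> exceed \<open>N\<close>, so both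
    joint laws equal the same product and the online trajectory can stand in for the one defining
    the calibrated violation probability.\<close>
  have exchange: "AE \<omega> in M. ?c (?out q) \<omega> = ?c (?out p) \<omega>"
    using iid_residuals_joint_law[OF iid] p q
    by (intro cond_prob_given_cong_joint_law[OF Y Eq Ep _ C']) simp
  have bad_out: "AE \<omega> in M. ?bad \<omega> \<longrightarrow> ?out q \<omega>"
    using terminal opt
  \<comment> \<open>The two almost sure hypotheses are peeled off, leaving a pointwise
    contradiction: inside the tube, the deterministic lemma applies to the realized parameter, state
    and disturbances.\<close>
  proof (rule AE_mp[OF _ AE_mp[OF _ AE_I2]], intro impI notI)
    fix \<omega> assume w: "\<omega> \<in> space M" and 1: "Xf (\<theta>hat (?Y \<omega>)) + S (\<theta>hat (?Y \<omega>)) H \<subseteq> X"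
      and 2: "mpc_optimal A B K X U H l lf (S (\<theta>hat (?Y \<omega>))) (Xf (\<theta>hat (?Y \<omega>)))
       (xk \<omega>) (z \<omega>) (v \<omega>)" and 3: "?bad \<omega>" and 4: "E q \<omega> \<in> Tube (\<theta>hat (?Y \<omega>))"
    have "\<theta>hat (?Y \<omega>) \<in> \<Theta>" using th measurable_space[OF Y w] by blast
    then have cs: "cross_sections H (Tube (\<theta>hat (?Y \<omega>))) (S (\<theta>hat (?Y \<omega>)))"
      using cross by blast
    have feas: "mpc_feasible A B K X U H (S (\<theta>hat (?Y \<omega>))) (Xf (\<theta>hat (?Y \<omega>))) (xk \<omega>) (z \<omega>) (v \<omega>)"
      using 2 by (simp add: mpc_optimal_def)
    have "err_traj A B K H (W \<omega>) \<in> Tube (\<theta>hat (?Y \<omega>))" using 4 online w by simp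
    from constraints_satisfied_in_tube[OF cs 1 feas this] 3 show False by blast
  qed
  have "{\<omega> \<in> space M. ?bad \<omega>} \<in> events"
    by (rule violation_event_measurable)
      (use X U W v xk in \<open>auto simp: constraint_set_def compact_imp_closed\<close>)
  moreover have "{\<omega> \<in> space M. ?out q \<omega>} \<in> events"
  proof -
    have "(\<lambda>\<omega>. (?Y \<omega>, E q \<omega>)) \<in> M \<rightarrow>\<^sub>M ?MY \<Otimes>\<^sub>M ?MZ" using Y Eq by measurable
    from measurable_sets[OF this C'] show ?thesis
      by (rule back_subst[of "\<lambda>A. A \<in> events"])
        (use measurable_space[OF Y] measurable_space[OF Eq] in \<open>auto simp: space_pair_measure\<close>)
  qed
  ultimately have "AE \<omega> in M. ?c ?bad \<omega> \<le> ?c (?out q) \<omega>"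
    using bad_out by (rule cond_prob_given_mono_AE[OF Y])
  with exchange have le: "AE \<omega> in M. ?c ?bad \<omega> \<le> ?c (?out p) \<omega>"
    by eventually_elim simp
  have [measurable]: "?c ?bad \<in> borel_measurable M"
    by (rule borel_measurable_cond_prob_given[OF Y])
  \<comment> \<open>Since the conditional violation probability is almost surely dominated by the
    conditional probability of leaving the tube, it stays below the level wherever the latter does,
    up to a null set. The larger event must be measurable for this comparison.\<close>
  have "\<P>(\<omega> in M. ?c (?out p) \<omega> \<le> eps_bound N s \<beta>) \<le> \<P>(\<omega> in M. ?c ?bad \<omega> \<le> eps_bound N s \<beta>)"
  proof (rule finite_measure_mono_AE)
    show "AE \<omega> in M. \<omega> \<in> {\<omega> \<in> space M. ?c (?out p) \<omega> \<le> eps_bound N s \<beta>} \<longrightarrow>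
        \<omega> \<in> {\<omega> \<in> space M. ?c ?bad \<omega> \<le> eps_bound N s \<beta>}"
      using le by eventually_elim auto
  qed measurable
  with cal show "\<P>(\<omega> in M. ?c ?bad \<omega> \<le> eps_bound N s \<beta>) \<ge> 1 - \<beta>"
    by linarith
qed

end
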